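(* Let $K$ be a global function field of characteristic $p$, fix a prime $\infty$ of $K$, let $\mathcal{O}$ be the ring of elements of $K$ regular at every prime other than $\infty$, and let $\mathbb{F}_q$ be the full constant field of $K$ (so $\mathcal{O}^*=\mathbb{F}_q^*$). Let $\phi\in\mathcal{O}[X]$ be a polynomial of degree at least $2$ with leading coefficient in $\mathcal{O}^*$, regarded as a map $K\to K$. Then every periodic point of $\phi$ in $K$ lies in $\mathcal{O}$ and has minimal period at most $q$.
   Context: A global function field is a finite extension of $\mathbb{F}_p(t)$; its primes are its places. The full constant field is the algebraic closure of $\mathbb{F}_p$ in $K$. A point $x\in K$ is periodic if $\phi^n(x)=x$ for some $n\geqslant 1$, where $\phi^n$ is the $n$-fold iterate; the least such $n$ is its minimal period. *)

theory Defs
  imports "HOL-Computational_Algebra.Polynomial"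
begin

definition prime_subfield :: "'a::field set" where
  "prime_subfield = range of_nat"

definition coeffs_in :: "'a::zero set \<Rightarrow> 'a poly \<Rightarrow> bool" where
  "coeffs_in S f \<longleftrightarrow> (\<forall>i. coeff f i \<in> S)"

definition transcendental_Fp :: "'a::field \<Rightarrow> bool" where
  "transcendental_Fp t \<longleftrightarrow>
     (\<forall>f. coeffs_in prime_subfield f \<and> poly f t = 0 \<longrightarrow> f = 0)"

definition rat_fun_subfield :: "'a::field \<Rightarrow> 'a set" where
  "rat_fun_subfield t = {poly f t / poly g t | f g.
       coeffs_in prime_subfield f \<and> coeffs_in prime_subfield g \<and> poly g t \<noteq> 0}"

definition global_function_field :: "'a::field itself \<Rightarrow> bool" where
  "global_function_field _ \<longleftrightarrow> prime CHAR('a) \<and>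
     (\<exists>t::'a. transcendental_Fp t \<and>
        (\<exists>B::'a set. finite B \<and>
           (\<forall>x::'a. \<exists>c. (\<forall>b\<in>B. c b \<in> rat_fun_subfield t) \<and> x = (\<Sum>b\<in>B. c b * b))))"

text \<open>Primes (places) of K, represented by their normalized discrete valuations
  v : K^* \<rightarrow> \<int> (surjective); the value at 0 is fixed to 0 as a convention (it stands
  for +\<infinity> and is never used). Every such valuation is trivial on F_p automatically.\<close>
definition is_place :: "('a::field \<Rightarrow> int) \<Rightarrow> bool" where
  "is_place v \<longleftrightarrow> v 0 = 0 \<and>
     (\<forall>x y. x \<noteq> 0 \<longrightarrow> y \<noteq> 0 \<longrightarrow> v (x * y) = v x + v y) \<and>
     (\<forall>x y. x \<noteq> 0 \<longrightarrow> y \<noteq> 0 \<longrightarrow> x + y \<noteq> 0 \<longrightarrow> v (x + y) \<ge> min (v x) (v y)) \<and>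
     v ` (UNIV - {0}) = UNIV"

definition ring_O :: "('a::field \<Rightarrow> int) \<Rightarrow> 'a set" where
  "ring_O vinf = {x. x = 0 \<or> (\<forall>v. is_place v \<and> v \<noteq> vinf \<longrightarrow> v x \<ge> 0)}"

definition constant_field :: "'a::field set" where
  "constant_field = {x. \<exists>f. f \<noteq> 0 \<and> coeffs_in prime_subfield f \<and> poly f x = 0}"

definition periodic_pt :: "('a \<Rightarrow> 'a) \<Rightarrow> 'a \<Rightarrow> bool" where
  "periodic_pt g x \<longleftrightarrow> (\<exists>n\<ge>1. (g ^^ n) x = x)"

definition minimal_period :: "('a \<Rightarrow> 'a) \<Rightarrow> 'a \<Rightarrow> nat" where
  "minimal_period g x = (LEAST n. n \<ge> 1 \<and> (g ^^ n) x = x)"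

end

(* Differences x_(i+1) - x_i of consecutive points of the orbit divide each other cyclically in O,
   so they are all multiples of d = x_1 - x_0 by elements of O^*; hence x_k - x_0 lies in F_q d for
   every k, and the period is at most q. Integrality holds because phi at least doubles the order of a pole.

   That O^* consists of constants amounts to this: a nonconstant u has a zero, i.e. there is a place
   with v(u) > 0. Take a subring R containing u and maximal among those without 1/u; it is a
   valuation ring. Counting sums s_0 + s_1 u + ... + s_(n-1) u^(n-1) after clearing denominators
   bounds the number of residue classes modulo any nonzero nonunit of R, so that R is discrete.
   The same count at the place at infinity shows that the field of constants is finite. *)
theory Submission
  imports Defs "HOL-Computational_Algebra.Primes" "HOL-Library.FuncSet" Complex_Main
begin

section \<open>Subrings, polynomials and constants\<close>

text \<open>Discreteness is where finiteness over F_p(t) has to enter, because a valuation ring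
  obtained from Zorn's lemma has a value group about which nothing is known. Instead of extending
  valuations of F_p(t) and controlling ramification, the proof counts. Expansions in base u with n
  digits that are pairwise incongruent modulo u are all different. They share a denominator, and the
  degrees of their numerators grow linearly in n, which leaves at most c M^n of them. The factor c
  may depend on the set of digits, since it is lost as n grows; M may not. As M is also independent
  of the ring, one statement serves both the unknown valuation ring and the ring of a given
  place.\<close>

definition is_subring :: "'a::field set \<Rightarrow> bool" where
  "is_subring A \<longleftrightarrow> 1 \<in> A \<and> (\<forall>x\<in>A. \<forall>y\<in>A. x - y \<in> A \<and> x * y \<in> A)"

lemma
  assumes "is_subring A"
  shows is_subring_1: "1 \<in> A"
    and is_subring_0: "0 \<in> A"
    and is_subring_diff: "x \<in> A \<Longrightarrow> y \<in> A \<Longrightarrow> x - y \<in> A"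
    and is_subring_mult: "x \<in> A \<Longrightarrow> y \<in> A \<Longrightarrow> x * y \<in> A"
    and is_subring_uminus: "x \<in> A \<Longrightarrow> - x \<in> A"
    and is_subring_add: "x \<in> A \<Longrightarrow> y \<in> A \<Longrightarrow> x + y \<in> A"
proof -
  show 1: "1 \<in> A" and d: "\<And>x y. x \<in> A \<Longrightarrow> y \<in> A \<Longrightarrow> x - y \<in> A"
    and m: "\<And>x y. x \<in> A \<Longrightarrow> y \<in> A \<Longrightarrow> x * y \<in> A"
    using assms by (auto simp: is_subring_def)
  show 0: "0 \<in> A" using d[OF 1 1] by simp
  show n: "\<And>x. x \<in> A \<Longrightarrow> - x \<in> A" using d[OF 0] by simp
  show "x \<in> A \<Longrightarrow> y \<in> A \<Longrightarrow> x + y \<in> A" using d[OF _ n, of x y] by simp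
qed

lemma is_subring_sum:
  assumes "is_subring A" "\<And>i. i \<in> I \<Longrightarrow> f i \<in> A"
  shows "sum f I \<in> A"
  using assms(2)
  by (induction I rule: infinite_finite_induct)
     (auto intro: is_subring_0[OF assms(1)] is_subring_add[OF assms(1)])

lemma is_subring_power:
  assumes "is_subring A" "x \<in> A"
  shows "x ^ n \<in> A"
  by (induction n) (auto intro: is_subring_1 is_subring_mult assms)

section \<open>Polynomials with coefficients in a subring\<close>

lemma coeffs_in_0: "0 \<in> A \<Longrightarrow> coeffs_in A 0"
  by (simp add: coeffs_in_def)

lemma coeffs_in_pCons_iff: "coeffs_in A (pCons a f) \<longleftrightarrow> a \<in> A \<and> coeffs_in A f"
  unfolding coeffs_in_def by (metis coeff_pCons_0 coeff_pCons_Suc not0_implies_Suc)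

lemma coeffs_in_add:
  "is_subring A \<Longrightarrow> coeffs_in A f \<Longrightarrow> coeffs_in A g \<Longrightarrow> coeffs_in A (f + g)"
  by (simp add: coeffs_in_def is_subring_add)

lemma coeffs_in_diff:
  "is_subring A \<Longrightarrow> coeffs_in A f \<Longrightarrow> coeffs_in A g \<Longrightarrow> coeffs_in A (f - g)"
  by (simp add: coeffs_in_def is_subring_diff)

lemma coeffs_in_mult:
  "is_subring A \<Longrightarrow> coeffs_in A f \<Longrightarrow> coeffs_in A g \<Longrightarrow> coeffs_in A (f * g)"
  by (auto simp: coeffs_in_def coeff_mult intro!: is_subring_sum is_subring_mult)

lemma coeffs_in_smult:
  "is_subring A \<Longrightarrow> a \<in> A \<Longrightarrow> coeffs_in A f \<Longrightarrow> coeffs_in A (smult a f)"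
  by (simp add: coeffs_in_def is_subring_mult)

lemma coeffs_in_monom: "is_subring A \<Longrightarrow> a \<in> A \<Longrightarrow> coeffs_in A (monom a n)"
  by (simp add: coeffs_in_def is_subring_0)

lemma coeffs_in_1: "is_subring A \<Longrightarrow> coeffs_in A 1"
  using coeffs_in_monom[of A 1 0] by (simp add: is_subring_1 flip: one_pCons monom_0)

lemma poly_in_subring:
  assumes "is_subring A" "coeffs_in A f" "x \<in> A"
  shows "poly f x \<in> A"
  using assms(2)
  by (induction f)
     (auto simp: coeffs_in_pCons_iff intro: is_subring_0 is_subring_add is_subring_mult assms)

text \<open>The Horner step writes x f(x) - y f(y) as (x - y) f(x) + y (f(x) - f(y)). Applied to two
  consecutive points of an orbit, it says that their difference divides the next one.\<close>

lemma poly_diff_divisible: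
  assumes A: "is_subring A" and f: "coeffs_in A f" and x: "x \<in> A" and y: "y \<in> A"
  shows "\<exists>w\<in>A. poly f x - poly f y = (x - y) * w"
  using f
proof (induction f)
  case 0
  then show ?case using is_subring_0[OF A] by force
next
  case (pCons a f)
  then obtain w where w: "w \<in> A" "poly f x - poly f y = (x - y) * w"
    by (auto simp: coeffs_in_pCons_iff)
  have "poly (pCons a f) x - poly (pCons a f) y
      = (x - y) * poly f x + y * (poly f x - poly f y)"
    by (simp add: algebra_simps)
  also have "\<dots> = (x - y) * (poly f x + y * w)"
    by (simp add: w algebra_simps)
  finally show ?case
    using pCons.prems w x y
    by (auto simp: coeffs_in_pCons_iff intro!: bexI[of _ "poly f x + y * w"]
        is_subring_add[OF A] is_subring_mult[OF A] poly_in_subring[OF A])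
qed

lemma polys_Suc:
  "{f. coeffs_in S f \<and> degree f \<le> Suc m}
   \<subseteq> case_prod pCons ` (S \<times> {f. coeffs_in S f \<and> degree f \<le> m})"
proof
  fix f assume f: "f \<in> {f. coeffs_in S f \<and> degree f \<le> Suc m}"
  obtain a g where fg: "f = pCons a g" by (cases f)
  have "degree g \<le> m" using f fg by (cases "g = 0") auto
  then show "f \<in> case_prod pCons ` (S \<times> {f. coeffs_in S f \<and> degree f \<le> m})"
    using f fg by (auto simp: coeffs_in_pCons_iff)
qed

lemma polys_0: "{f. coeffs_in S f \<and> degree f \<le> 0} \<subseteq> (\<lambda>a. [:a:]) ` S"
  by (auto elim!: degree_eq_zeroE simp: coeffs_in_pCons_iff)

lemma finite_card_polys:
  assumes "finite S"
  shows "finite {f. coeffs_in S f \<and> degree f \<le> m} \<and>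
         card {f. coeffs_in S f \<and> degree f \<le> m} \<le> card S ^ Suc m"
proof (induction m)
  case 0
  show ?case
    using assms polys_0[of S] by (auto intro: finite_subset surj_card_le)
next
  case (Suc m)
  let ?P = "\<lambda>m. {f. coeffs_in S f \<and> degree f \<le> m}"
  have fin: "finite (S \<times> ?P m)" using assms Suc by blast
  have "card (?P (Suc m)) \<le> card (S \<times> ?P m)"
    using fin polys_Suc by (rule surj_card_le)
  also have "\<dots> \<le> card S ^ Suc (Suc m)"
    using Suc by (simp add: card_cartesian_product)
  finally show ?case using finite_surj[OF fin polys_Suc] by simp
qed

text \<open>Multiplication by a nonzero \<open>x\<close> is injective on the finite set, hence hits
  1. This lets polynomials over \<open>prime_subfield\<close> be made monic.\<close>

lemma finite_subring_inverse:
  assumes A: "is_subring A" "finite A" and x: "x \<in> A"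
  shows "inverse x \<in> A"
proof (cases "x = 0")
  case False
  have "(*) x ` A \<subseteq> A" using A x by (auto intro: is_subring_mult)
  moreover have "inj_on ((*) x) A" using False by (auto intro: inj_onI)
  ultimately have "(*) x ` A = A" using A(2) by (simp add: endo_inj_surj)
  then obtain y where "y \<in> A" "x * y = 1" using is_subring_1[OF A(1)] by (metis imageE)
  then show ?thesis by (metis inverse_unique)
qed (use x in simp)

section \<open>The prime subfield and the field of constants\<close>

lemma is_subring_prime_subfield:
  assumes "prime CHAR('a::field)"
  shows "is_subring (prime_subfield :: 'a set)"
proof -
  \<comment> \<open>\<open>prime_subfield\<close> consists of images of naturals, so differences
    have to be rewritten without subtraction: -n becomes n (p - 1).\<close>
  have "(-1 :: 'a) = of_nat (CHAR('a) - 1)"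
    using assms by (subst of_nat_diff) (auto simp: prime_gt_0_nat Suc_le_eq)
  then have diff: "of_nat m - of_nat n = (of_nat (m + n * (CHAR('a) - 1)) :: 'a)" for m n
    by (simp only: of_nat_add of_nat_mult flip: \<open>-1 = _\<close>) simp
  have "1 \<in> (range of_nat :: 'a set)" by (metis of_nat_1 rangeI)
  moreover have "of_nat m - of_nat n \<in> (range of_nat :: 'a set)" for m n
    unfolding diff by (rule rangeI)
  moreover have "of_nat m * of_nat n \<in> (range of_nat :: 'a set)" for m n
    by (metis of_nat_mult rangeI)
  ultimately show ?thesis
    unfolding is_subring_def prime_subfield_def by blast
qed

lemma finite_prime_subfield:
  assumes "prime CHAR('a::field)"
  shows "finite (prime_subfield :: 'a set)"
proof -
  have "of_nat n = (of_nat (n mod CHAR('a)) :: 'a)" for n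
  proof -
    have "(of_nat n :: 'a) = of_nat (n div CHAR('a) * CHAR('a) + n mod CHAR('a))" by simp
    also have "\<dots> = of_nat (n mod CHAR('a))"
      by (simp only: of_nat_add of_nat_mult of_nat_CHAR) simp
    finally show ?thesis .
  qed
  moreover have "n mod CHAR('a) < CHAR('a)" for n
    using assms by (simp add: prime_gt_0_nat)
  ultimately have "(prime_subfield :: 'a set) \<subseteq> of_nat ` {..<CHAR('a)}"
    unfolding prime_subfield_def by blast
  then show ?thesis by (rule finite_subset) simp
qed

text \<open>Modulo a monic relation of degree d + 1, every power of \<open>x\<close> reduces to the
  value of a polynomial of degree at most d, and over a finite field there are finitely many of
  these.\<close>

lemma finite_powers_of_algebraic:
  fixes x :: "'a::field"
  assumes p: "prime CHAR('a)" and x: "x \<in> constant_field"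
  shows "finite (range (\<lambda>n. x ^ n))"
proof -
  let ?F = "prime_subfield :: 'a set"
  note F = is_subring_prime_subfield[OF p] and Ffin = finite_prime_subfield[OF p]
  obtain f where f: "f \<noteq> 0" "coeffs_in ?F f" "poly f x = 0"
    using x by (auto simp: constant_field_def)
  define g where "g = smult (inverse (lead_coeff f)) f"
  have g: "coeffs_in ?F g" "poly g x = 0" "lead_coeff g = 1"
    using f unfolding g_def
    by (auto intro!: coeffs_in_smult[OF F] finite_subring_inverse[OF F Ffin])
      (simp add: coeffs_in_def)
  have "degree g \<noteq> 0"
  proof
    assume "degree g = 0"
    then obtain a where "g = [:a:]" by (rule degree_eq_zeroE)
    then show False using g by simp
  qed
  then obtain d where d: "degree g = Suc d" using not0_implies_Suc by blast
  let ?P = "{h. coeffs_in ?F h \<and> degree h \<le> d}"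
  have "x ^ n \<in> (\<lambda>h. poly h x) ` ?P" for n
  proof (induction n)
    case 0
    show ?case using coeffs_in_1[OF F] by (auto intro!: image_eqI[of _ _ 1])
  next
    case (Suc n)
    then obtain h where h: "coeffs_in ?F h" "degree h \<le> d" "poly h x = x ^ n" by auto
    \<comment> \<open>Multiplying \<open>h\<close> by X may create a term of degree d + 1. Its
      coefficient is \<open>coeff h d\<close>, and subtracting that multiple of the monic
      \<open>g\<close> removes it.\<close>
    define k where "k = pCons 0 h - smult (coeff h d) g"
    have "coeffs_in ?F k"
      using F g h unfolding k_def
      by (auto intro!: coeffs_in_diff coeffs_in_smult simp: coeffs_in_pCons_iff is_subring_0)
        (simp add: coeffs_in_def)
    moreover have "degree k \<le> d"
    proof (rule degree_le, intro allI impI)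
      fix i assume "d < i"
      then obtain j where j: "i = Suc j" "d \<le> j" by (metis Suc_leI Suc_le_D Suc_le_mono)
      show "coeff k i = 0"
      proof (cases "j = d")
        case True
        then show ?thesis using g d j by (simp add: k_def)
      next
        case False
        then have "coeff h j = 0" "coeff g i = 0"
          using h d j by (auto intro!: coeff_eq_0)
        then show ?thesis using j by (simp add: k_def)
      qed
    qed
    moreover have "poly k x = x ^ Suc n" using g h by (simp add: k_def)
    ultimately show ?case by (auto intro!: image_eqI[of _ _ k])
  qed
  then have "range (\<lambda>n. x ^ n) \<subseteq> (\<lambda>h. poly h x) ` ?P" by blast
  then show ?thesis
    using finite_card_polys[OF Ffin] finite_surj by blast
qed

text \<open>Finitely many powers force two Frobenius iterates of \<open>x\<close> to coincide, and
  injectivity of Frobenius cancels the smaller exponent. Conversely \<open>x\<close> is a root of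
  X^(p^k) - X, which is nonzero because k \<ge> 1. In this form closure under addition follows from
  additivity of Frobenius.\<close>

lemma constant_field_iff:
  fixes x :: "'a::field"
  assumes p: "prime CHAR('a)"
  shows "x \<in> constant_field \<longleftrightarrow> (\<exists>k\<ge>1. x ^ (CHAR('a) ^ k) = x)"
proof
  assume x: "x \<in> constant_field"
  have "finite (range (\<lambda>i. x ^ (CHAR('a) ^ i)))"
    using finite_powers_of_algebraic[OF p x] by (rule rev_finite_subset) auto
  then have "\<not> inj (\<lambda>i. x ^ (CHAR('a) ^ i))"
    using finite_imageD by blast
  then obtain i j where ij: "i < j" "x ^ (CHAR('a) ^ i) = x ^ (CHAR('a) ^ j)"
    unfolding inj_def by (metis linorder_neqE_nat)
  define k where "k = j - i"
  define z where "z = x ^ (CHAR('a) ^ k)"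
  have "(z - x + x) ^ (CHAR('a) ^ i) = (z - x) ^ (CHAR('a) ^ i) + x ^ (CHAR('a) ^ i)"
    by (rule freshmans_dream') (use p in auto)
  moreover have "z ^ (CHAR('a) ^ i) = x ^ (CHAR('a) ^ i)"
    using ij unfolding z_def k_def by (simp flip: power_mult power_add)
  ultimately have "(z - x) ^ (CHAR('a) ^ i) = 0" by simp
  then have "z = x" by simp
  then show "\<exists>k\<ge>1. x ^ (CHAR('a) ^ k) = x" using ij by (auto simp: z_def k_def intro!: exI[of _ "j - i"])
next
  assume "\<exists>k\<ge>1. x ^ (CHAR('a) ^ k) = x"
  then obtain k where k: "k \<ge> 1" "x ^ (CHAR('a) ^ k) = x" by blast
  define f where "f = monom 1 (CHAR('a) ^ k) - (monom 1 1 :: 'a poly)"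
  have "CHAR('a) ^ k > 1" using p k prime_gt_1_nat by (metis one_less_power zero_less_one less_le_trans)
  then have "coeff f 1 = -1" using k by (simp add: f_def)
  then have "f \<noteq> 0" by auto
  moreover have "coeffs_in prime_subfield f"
    unfolding f_def using is_subring_prime_subfield[OF p]
    by (intro coeffs_in_diff coeffs_in_monom) (auto intro: is_subring_1)
  moreover have "poly f x = 0" using k by (simp add: f_def poly_monom)
  ultimately show "x \<in> constant_field" unfolding constant_field_def by blast
qed

lemma power_iterate_fixed:
  fixes x :: "'a::monoid_mult"
  assumes "x ^ (q ^ k) = x"
  shows "x ^ (q ^ (k * l)) = x"
proof (induction l)
  case (Suc l)
  then show ?case using assms by (simp add: power_add power_mult)
qed simp

lemma constant_field_add:
  fixes x y :: "'a::field"
  assumes p: "prime CHAR('a)" and "x \<in> constant_field" "y \<in> constant_field"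
  shows "x + y \<in> constant_field"
proof -
  obtain k l where k: "k \<ge> 1" "x ^ (CHAR('a) ^ k) = x" and l: "l \<ge> 1" "y ^ (CHAR('a) ^ l) = y"
    using assms by (auto simp: constant_field_iff)
  have "(x + y) ^ (CHAR('a) ^ (k * l)) = x ^ (CHAR('a) ^ (k * l)) + y ^ (CHAR('a) ^ (l * k))"
    using p by (subst freshmans_dream') (auto simp: mult.commute)
  then have "(x + y) ^ (CHAR('a) ^ (k * l)) = x + y"
    using k l by (simp add: power_iterate_fixed)
  then show ?thesis using k l by (subst constant_field_iff[OF p]) (auto intro!: exI[of _ "k * l"])
qed

lemma constant_field_minus:
  fixes x :: "'a::field"
  assumes p: "prime CHAR('a)" and x: "x \<in> constant_field"
  shows "- x \<in> constant_field"
proof -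
  obtain k where k: "k \<ge> 1" "x ^ (CHAR('a) ^ k) = x"
    using assms by (auto simp: constant_field_iff)
  have "(- x + x) ^ (CHAR('a) ^ k) = (- x) ^ (CHAR('a) ^ k) + x ^ (CHAR('a) ^ k)"
    by (rule freshmans_dream') (use p in auto)
  then have "(- x) ^ (CHAR('a) ^ k) = - x"
    using k p by (metis add.left_inverse add_eq_0_iff2 power_0_left prime_gt_0_nat
        zero_less_power less_irrefl)
  then show ?thesis using k by (auto simp: constant_field_iff[OF p])
qed

lemma zero_in_constant_field: "(0::'a::field) \<in> constant_field" if "prime CHAR('a)"
  using that by (auto simp: constant_field_iff prime_gt_0_nat intro!: exI[of _ 1])

lemma constant_field_root_of_unity:
  fixes x :: "'a::field"
  assumes p: "prime CHAR('a)" and x: "x \<in> constant_field" "x \<noteq> 0"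
  shows "\<exists>m>0. x ^ m = 1"
proof -
  obtain k where k: "k \<ge> 1" "x ^ (CHAR('a) ^ k) = x"
    using assms by (auto simp: constant_field_iff)
  have q: "CHAR('a) ^ k > 1" using p k prime_gt_1_nat by (metis one_less_power zero_less_one less_le_trans)
  then have "x ^ (CHAR('a) ^ k) = x * x ^ (CHAR('a) ^ k - 1)"
    by (metis power_eq_if not_one_less_zero)
  then have "x ^ (CHAR('a) ^ k - 1) = 1" using k x by simp
  then show ?thesis using q by (metis zero_less_diff)
qed

section \<open>Counting residue classes\<close>

text \<open>Exponential growth with a larger base beats any constant factor. In the count below,
  \<open>c\<close> depends on the set being counted while \<open>M\<close> does not.\<close>

lemma power_bound_imp_le:
  fixes s M c :: nat
  assumes "\<And>n. s ^ n \<le> c * M ^ n"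
  shows "s \<le> M"
proof (rule ccontr)
  assume "\<not> s \<le> M"
  then have sM: "M < s" by simp
  have "M \<noteq> 0" using assms[of 1] sM by (cases "M = 0") auto
  then have "1 < real s / real M" using sM by simp
  then obtain n where "real c < (real s / real M) ^ n" using real_arch_pow by blast
  then have "real c * real M ^ n < real s ^ n"
    using \<open>M \<noteq> 0\<close> by (simp add: power_divide field_simps)
  then have "c * M ^ n < s ^ n"
    by (metis of_nat_less_iff of_nat_mult of_nat_power)
  then show False using assms[of n] by simp
qed

text \<open>Base-\<open>u\<close> expansions with n digits from \<open>S\<close>, lowest digit
  outermost, so that reduction modulo \<open>u\<close> exposes one digit at a time.\<close>

primrec horner_set :: "'a::semiring_0 set \<Rightarrow> 'a \<Rightarrow> nat \<Rightarrow> 'a set" where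
  "horner_set S u 0 = {0}"
| "horner_set S u (Suc n) = (\<lambda>(s, y). s + u * y) ` (S \<times> horner_set S u n)"

lemma horner_set_in_subring:
  assumes "is_subring A" "S \<subseteq> A" "u \<in> A"
  shows "horner_set S u n \<subseteq> A"
proof (induction n)
  case 0
  show ?case using is_subring_0[OF assms(1)] by simp
next
  case (Suc n)
  then show ?case
    using assms by (force intro: is_subring_add[OF assms(1)] is_subring_mult[OF assms(1)])
qed

text \<open>Uniqueness of expansions: pairwise incongruence determines the lowest digit, and
  cancelling \<open>u\<close> leaves shorter expansions.\<close>

lemma card_horner_set:
  assumes A: "is_subring A" and S: "S \<subseteq> A" and u: "u \<in> A" "u \<noteq> 0"
    and inc: "\<And>s s' a. s \<in> S \<Longrightarrow> s' \<in> S \<Longrightarrow> a \<in> A \<Longrightarrow> s - s' = u * a \<Longrightarrow> s = s'"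
  shows "card (horner_set S u n) = card S ^ n"
proof (induction n)
  case (Suc n)
  have "inj_on (\<lambda>(s, y). s + u * y) (S \<times> horner_set S u n)"
  proof (rule inj_onI, clarify)
    fix s y s' y'
    assume s: "s \<in> S" "s' \<in> S" and y: "y \<in> horner_set S u n" "y' \<in> horner_set S u n"
      and eq: "s + u * y = s' + u * y'"
    have "s - s' = u * (y' - y)" using eq by (simp add: algebra_simps)
    moreover have "y' - y \<in> A"
      using y horner_set_in_subring[OF A S u(1)] by (blast intro: is_subring_diff[OF A])
    ultimately have "s = s'" using inc s by blast
    then show "s = s' \<and> y = y'" using eq u by simp
  qed
  then show ?case using Suc by (simp add: card_image card_cartesian_product)
qed simp

section \<open>Combinations of generators with polynomial coefficients of bounded degree\<close>

locale finite_over_rational_functions =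
  fixes t :: "'a::field" and B :: "'a set"
  assumes prime_char: "prime CHAR('a)"
    and finite_B: "finite B"
    and spanning: "\<And>x. \<exists>c. (\<forall>b\<in>B. c b \<in> rat_fun_subfield t) \<and> x = (\<Sum>b\<in>B. c b * b)"
begin

abbreviation Fp :: "'a set" where "Fp \<equiv> prime_subfield"

lemmas subring_Fp = is_subring_prime_subfield[OF prime_char]
lemmas finite_Fp = finite_prime_subfield[OF prime_char]

text \<open>Serves as a Riemann-Roch space without divisors: a finite F_p-space whose dimension
  grows at most linearly in \<open>m\<close>. The conditions on \<open>f\<close> range over all
  \<open>b\<close>, so that no side condition b \<in> B has to be carried along.\<close>

definition W :: "nat \<Rightarrow> 'a set" where
  "W m = {\<Sum>b\<in>B. poly (f b) t * b | f. \<forall>b. coeffs_in Fp (f b) \<and> degree (f b) \<le> m}"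

lemma W_I:
  "(\<And>b. coeffs_in Fp (f b)) \<Longrightarrow> (\<And>b. degree (f b) \<le> m)
   \<Longrightarrow> (\<Sum>b\<in>B. poly (f b) t * b) \<in> W m"
  unfolding W_def by (intro CollectI exI[of _ f]) simp

lemma W_E:
  assumes "x \<in> W m"
  obtains f where "\<And>b. coeffs_in Fp (f b)" "\<And>b. degree (f b) \<le> m"
    "x = (\<Sum>b\<in>B. poly (f b) t * b)"
  using assms unfolding W_def by (elim CollectE exE conjE) (rule that, simp_all)

lemma W_mono:
  assumes "m \<le> n"
  shows "W m \<subseteq> W n"
proof
  fix x assume "x \<in> W m"
  then obtain f where f: "\<And>b. coeffs_in Fp (f b)" "\<And>b. degree (f b) \<le> m"
    "x = (\<Sum>b\<in>B. poly (f b) t * b)" by (rule W_E) blast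
  show "x \<in> W n"
    unfolding f(3) using f(1,2) assms by (intro W_I) (auto intro: order_trans)
qed

lemma W_0: "0 \<in> W m"
  using W_I[of "\<lambda>_. 0" m] by (simp add: coeffs_in_0 is_subring_0[OF subring_Fp])

lemma W_add:
  assumes "x \<in> W m" "y \<in> W m"
  shows "x + y \<in> W m"
proof -
  obtain f where f: "\<And>b. coeffs_in Fp (f b)" "\<And>b. degree (f b) \<le> m"
    "x = (\<Sum>b\<in>B. poly (f b) t * b)" using assms(1) by (rule W_E) blast
  obtain g where g: "\<And>b. coeffs_in Fp (g b)" "\<And>b. degree (g b) \<le> m"
    "y = (\<Sum>b\<in>B. poly (g b) t * b)" using assms(2) by (rule W_E) blast
  have "(\<Sum>b\<in>B. poly (f b + g b) t * b) \<in> W m"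
    using f g by (intro W_I) (auto intro: coeffs_in_add[OF subring_Fp] degree_add_le)
  then show ?thesis by (simp add: f g sum.distrib algebra_simps)
qed

lemma W_sum: "(\<And>i. i \<in> I \<Longrightarrow> f i \<in> W m) \<Longrightarrow> sum f I \<in> W m"
  by (induction I rule: infinite_finite_induct) (auto intro: W_0 W_add)

lemma W_poly_mult:
  assumes h: "coeffs_in Fp h" "degree h \<le> k" and x: "x \<in> W m"
  shows "poly h t * x \<in> W (k + m)"
proof -
  obtain f where f: "\<And>b. coeffs_in Fp (f b)" "\<And>b. degree (f b) \<le> m"
    "x = (\<Sum>b\<in>B. poly (f b) t * b)" using x by (rule W_E) blast
  have "(\<Sum>b\<in>B. poly (h * f b) t * b) \<in> W (k + m)"
  proof (rule W_I)
    fix b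
    show "coeffs_in Fp (h * f b)" by (rule coeffs_in_mult[OF subring_Fp h(1) f(1)])
    show "degree (h * f b) \<le> k + m"
      using degree_mult_le[of h "f b"] h(2) f(2)[of b] by linarith
  qed
  then show ?thesis by (simp add: f sum_distrib_left algebra_simps)
qed

lemma finite_card_W:
  "finite (W m) \<and> card (W m) \<le> (card Fp ^ Suc m) ^ card B"
proof -
  let ?P = "{f. coeffs_in Fp f \<and> degree f \<le> m}"
  let ?ev = "\<lambda>f. \<Sum>b\<in>B. poly (f b) t * b"
  have P: "finite ?P" "card ?P \<le> card Fp ^ Suc m"
    using finite_card_polys[OF finite_Fp] by auto
  have fin: "finite (B \<rightarrow>\<^sub>E ?P)" using P finite_B by (intro finite_PiE) auto
  \<comment> \<open>Many functions \<open>f\<close> agree on \<open>B\<close>; restriction to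
    \<open>B\<close> selects extensional representatives, which form a finite set.\<close>
  have sub: "W m \<subseteq> ?ev ` (B \<rightarrow>\<^sub>E ?P)"
  proof
    fix x assume "x \<in> W m"
    then obtain f where f: "\<And>b. coeffs_in Fp (f b)" "\<And>b. degree (f b) \<le> m"
      "x = (\<Sum>b\<in>B. poly (f b) t * b)" by (rule W_E) blast
    then show "x \<in> ?ev ` (B \<rightarrow>\<^sub>E ?P)"
      by (intro image_eqI[of _ _ "restrict f B"]) (auto intro!: sum.cong)
  qed
  have "card (W m) \<le> card (B \<rightarrow>\<^sub>E ?P)" using fin sub by (rule surj_card_le)
  also have "\<dots> = card ?P ^ card B" using finite_B by (simp add: card_PiE)
  also have "\<dots> \<le> (card Fp ^ Suc m) ^ card B" using P by (intro power_mono) auto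
  finally show ?thesis using finite_surj[OF fin sub] by simp
qed

definition clears :: "'a poly \<Rightarrow> nat \<Rightarrow> 'a \<Rightarrow> bool" where
  "clears D m x \<longleftrightarrow> coeffs_in Fp D \<and> poly D t \<noteq> 0 \<and> poly D t * x \<in> W m"

lemma clears_mult:
  assumes "clears D m x" "coeffs_in Fp E" "poly E t \<noteq> 0"
  shows "clears (E * D) (degree E + m) x"
proof -
  have "poly E t * (poly D t * x) \<in> W (degree E + m)"
    using assms by (intro W_poly_mult) (simp_all add: clears_def)
  then show ?thesis
    using assms by (simp add: clears_def mult.assoc coeffs_in_mult[OF subring_Fp])
qed

lemma clears_mono: "clears D m x \<Longrightarrow> m \<le> n \<Longrightarrow> clears D n x"
  using subsetD[OF W_mono] by (simp add: clears_def)

lemma clears_common: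
  assumes "finite S" "\<And>x. x \<in> S \<Longrightarrow> \<exists>D m. clears D m x"
  shows "\<exists>D m. coeffs_in Fp D \<and> poly D t \<noteq> 0 \<and> (\<forall>x\<in>S. clears D m x)"
  using assms
proof (induction S)
  case empty
  have "coeffs_in Fp 1 \<and> poly 1 t \<noteq> 0" by (simp add: coeffs_in_1[OF subring_Fp])
  then show ?case by blast
next
  case (insert y S)
  have "\<exists>D m. coeffs_in Fp D \<and> poly D t \<noteq> 0 \<and> (\<forall>x\<in>S. clears D m x)"
    by (rule insert.IH) (rule insert.prems, simp)
  then obtain D m where D: "coeffs_in Fp D" "poly D t \<noteq> 0" "\<forall>x\<in>S. clears D m x"
    by blast
  obtain E k where E: "clears E k y" using insert.prems[of y] by auto
  then have E': "coeffs_in Fp E" "poly E t \<noteq> 0" by (auto simp: clears_def)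
  \<comment> \<open>The bound for \<open>y\<close> comes from multiplying its denominator
    \<open>E\<close> by \<open>D\<close>, the bound for the old elements from multiplying
    \<open>D\<close> by \<open>E\<close>; the sum dominates both.\<close>
  define N where "N = (degree E + m) + (degree D + k)"
  have "clears (E * D) N x" if "x \<in> insert y S" for x
  proof (cases "x = y")
    case True
    have "clears (D * E) N y"
      by (rule clears_mono[OF clears_mult[OF E D(1,2)]]) (simp add: N_def)
    then show ?thesis using True by (simp add: mult.commute)
  next
    case False
    then have "clears D m x" using that D(3) by simp
    from clears_mult[OF this E'] show ?thesis
      by (rule clears_mono) (simp add: N_def)
  qed
  then show ?case
    using D E' coeffs_in_mult[OF subring_Fp E'(1) D(1)]
    by (intro exI[of _ "E * D"] exI[of _ N]) simp
qed

lemma clears_add: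
  assumes "\<exists>D m. clears D m x" "\<exists>D m. clears D m y"
  shows "\<exists>D m. clears D m (x + y)"
proof -
  have "\<exists>D m. coeffs_in Fp D \<and> poly D t \<noteq> 0 \<and> (\<forall>z\<in>{x, y}. clears D m z)"
    using assms by (intro clears_common) auto
  then obtain D m where D: "\<forall>z\<in>{x, y}. clears D m z" by blast
  then have "clears D m (x + y)"
    by (auto simp: clears_def distrib_left intro: W_add)
  then show ?thesis by blast
qed

lemma generator_multiple_in_W:
  assumes "b \<in> B" "coeffs_in Fp f" "degree f \<le> m"
  shows "poly f t * b \<in> W m"
proof -
  have "(\<Sum>b'\<in>B. poly (if b' = b then f else 0) t * b') \<in> W m"
    using assms by (intro W_I) (auto simp: coeffs_in_0 is_subring_0[OF subring_Fp])
  also have "(\<Sum>b'\<in>B. poly (if b' = b then f else 0) t * b')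
      = (\<Sum>b'\<in>B. if b' = b then poly f t * b' else 0)"
    by (intro sum.cong) auto
  also have "\<dots> = poly f t * b" using assms finite_B by simp
  finally show ?thesis .
qed

lemma ex_clears: "\<exists>D m. clears D m x"
proof -
  obtain c where c: "\<And>b. b \<in> B \<Longrightarrow> c b \<in> rat_fun_subfield t" "x = (\<Sum>b\<in>B. c b * b)"
    using spanning[of x] by (elim exE conjE) auto
  have single: "\<exists>D m. clears D m (c b * b)" if b: "b \<in> B" for b
  proof -
    obtain f g where fg: "c b = poly f t / poly g t" "coeffs_in Fp f" "coeffs_in Fp g"
      "poly g t \<noteq> 0" using c(1)[OF b] unfolding rat_fun_subfield_def by blast
    have "clears g (degree f) (c b * b)"
      using fg generator_multiple_in_W[OF b fg(2) order_refl] by (simp add: clears_def)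
    then show ?thesis by blast
  qed
  have "\<exists>D m. clears D m (\<Sum>b\<in>B'. c b * b)" if "B' \<subseteq> B" "finite B'" for B'
    using that(2,1)
  proof (induction B')
    case empty
    then show ?case
      using W_0 coeffs_in_1[OF subring_Fp] by (auto simp: clears_def intro!: exI[of _ 1])
  next
    case (insert b B')
    then show ?case using single[of b] by (auto intro!: clears_add)
  qed
  then show ?thesis using c(2) finite_B by blast
qed

text \<open>Each multiplication by \<open>u\<close> costs one factor \<open>poly D t\<close> and
  raises the degree bound by \<open>e\<close>, because \<open>D\<close> clears all products of
  \<open>u\<close> with generators. The denominator \<open>E\<close> of the digits is paid for
  once.\<close>

lemma horner_set_clears:
  assumes E: "\<And>s. s \<in> S \<Longrightarrow> clears E m s" "coeffs_in Fp E"
    and D: "coeffs_in Fp D" "degree D \<le> e"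
    and Du: "\<And>b. b \<in> B \<Longrightarrow> poly D t * (u * b) \<in> W e"
    and y: "y \<in> horner_set S u n"
  shows "poly D t ^ n * poly E t * y \<in> W (m + n * e)"
  using y
proof (induction n arbitrary: y)
  case 0
  then show ?case by (simp add: W_0)
next
  case (Suc n)
  then obtain s z where y: "y = s + u * z" and s: "s \<in> S" and z: "z \<in> horner_set S u n"
    by auto
  \<comment> \<open>The new digit has to be multiplied by the same power of \<open>poly D t\<close>
    as the rest of the sum; \<open>degree D \<le> e\<close> keeps it within the same bound.\<close>
  have pow: "poly D t ^ k * w \<in> W (k * e + l)" if "w \<in> W l" for k w l
  proof (induction k)
    case (Suc k)
    then show ?case
      using W_poly_mult[OF D Suc] by (simp add: algebra_simps)
  qed (use that in simp)
  have "poly D t ^ Suc n * (poly E t * s) \<in> W (Suc n * e + m)"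
    using E(1)[OF s] by (intro pow) (simp add: clears_def)
  \<comment> \<open>Multiplication by \<open>poly D t * u\<close> is linear over F_p[t], so its
    effect on \<open>W l\<close> is read off from the generators.\<close>
  moreover have "poly D t * (u * w) \<in> W (l + e)" if w: "w \<in> W l" for w l
  proof -
    obtain f where f: "\<And>b. coeffs_in Fp (f b)" "\<And>b. degree (f b) \<le> l"
      "w = (\<Sum>b\<in>B. poly (f b) t * b)" using w by (rule W_E) blast
    have "(\<Sum>b\<in>B. poly (f b) t * (poly D t * (u * b))) \<in> W (l + e)"
      using f Du by (intro W_sum W_poly_mult) auto
    then show ?thesis by (simp add: f sum_distrib_left algebra_simps)
  qed
  from this[OF Suc.IH[OF z]]
  have "poly D t * (u * (poly D t ^ n * poly E t * z)) \<in> W (m + n * e + e)" .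
  ultimately have "poly D t ^ Suc n * (poly E t * s)
      + poly D t * (u * (poly D t ^ n * poly E t * z)) \<in> W (m + Suc n * e)"
    by (intro W_add) (simp_all add: algebra_simps)
  then show ?case by (simp add: y algebra_simps)
qed

text \<open>With denominators cleared, the sums in \<open>horner_set S u n\<close> lie in a space of dimension linear
  in \<open>n\<close>, so their number grows at most like \<open>M\<^sup>n\<close>; and \<open>M\<close> depends on \<open>u\<close> only.\<close>

lemma incongruent_bound:
  fixes u :: 'a
  obtains M :: nat where
    "\<And>A S. is_subring A \<Longrightarrow> S \<subseteq> A \<Longrightarrow> u \<in> A \<Longrightarrow> u \<noteq> 0 \<Longrightarrow> finite S \<Longrightarrow>
       (\<And>s s' a. s \<in> S \<Longrightarrow> s' \<in> S \<Longrightarrow> a \<in> A \<Longrightarrow> s - s' = u * a \<Longrightarrow> s = s') \<Longrightarrow> card S \<le> M"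
proof -
  have "\<exists>D m. coeffs_in Fp D \<and> poly D t \<noteq> 0 \<and> (\<forall>x\<in>(*) u ` B. clears D m x)"
    using finite_B ex_clears by (intro clears_common) auto
  then obtain D e0 where D: "coeffs_in Fp D" "poly D t \<noteq> 0"
      "\<And>b. b \<in> B \<Longrightarrow> clears D e0 (u * b)"
    by blast
  define e where "e = e0 + degree D"
  have Du: "poly D t * (u * b) \<in> W e" if "b \<in> B" for b
    using D(3)[OF that] W_mono[of e0 e] by (auto simp: clears_def e_def)
  define q where "q = card Fp"
  \<comment> \<open>One more digit raises the degree bound by \<open>e\<close>, which gives each of
    the \<open>card B\<close> coefficients \<open>e\<close> further entries from
    \<open>prime_subfield\<close>: this is the growth factor per digit.\<close>
  define M where "M = (q ^ e) ^ card B"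
  show ?thesis
  proof (rule that[of M])
    fix A S assume A: "is_subring A" "S \<subseteq> A" "u \<in> A" "u \<noteq> 0" and S: "finite S"
      and inc: "\<And>s s' a. s \<in> S \<Longrightarrow> s' \<in> S \<Longrightarrow> a \<in> A \<Longrightarrow> s - s' = u * a \<Longrightarrow> s = s'"
    \<comment> \<open>\<open>E\<close> and \<open>m\<close> depend on \<open>S\<close>, but they
      affect only the factor in front of \<open>M ^ n\<close>.\<close>
    obtain E m where E: "coeffs_in Fp E" "poly E t \<noteq> 0" "\<And>s. s \<in> S \<Longrightarrow> clears E m s"
      using clears_common[OF S ex_clears] by blast
    show "card S \<le> M"
    proof (rule power_bound_imp_le)
      fix n
      let ?g = "\<lambda>y. poly D t ^ n * poly E t * y"
      have "card S ^ n = card (horner_set S u n)"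
        using card_horner_set[OF A inc] by simp
      also have "\<dots> \<le> card (W (m + n * e))"
      proof (rule card_inj_on_le)
        show "inj_on ?g (horner_set S u n)" using D(2) E(2) by (auto intro: inj_onI)
        show "?g ` horner_set S u n \<subseteq> W (m + n * e)"
          using horner_set_clears[OF E(3) E(1) D(1) _ Du] by (auto simp: e_def)
      qed (use finite_card_W in blast)
      also have "\<dots> \<le> (q ^ Suc (m + n * e)) ^ card B"
        using finite_card_W unfolding q_def by blast
      also have "\<dots> = (q ^ Suc m) ^ card B * M ^ n"
      proof -
        have "q ^ Suc (m + n * e) = q ^ Suc m * (q ^ e) ^ n"
          by (simp add: power_add mult.commute[of n e] flip: power_mult)
        then show ?thesis
          by (simp only: M_def power_mult_distrib flip: power_mult) (simp add: ac_simps)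
      qed
      finally show "card S ^ n \<le> (q ^ Suc m) ^ card B * M ^ n" .
    qed
  qed
qed

end

section \<open>Maximal subrings avoiding an inverse\<close>

lemma is_subring_poly_values:
  assumes "is_subring A"
  shows "is_subring {poly f x | f. coeffs_in A f}"
proof -
  have "\<exists>h. poly f x - poly g x = poly h x \<and> coeffs_in A h"
    and "\<exists>h. poly f x * poly g x = poly h x \<and> coeffs_in A h"
    if "coeffs_in A f" "coeffs_in A g" for f g
    using coeffs_in_diff[OF assms that] coeffs_in_mult[OF assms that]
    by (metis poly_diff, metis poly_mult)
  moreover have "\<exists>h. 1 = poly h x \<and> coeffs_in A h"
    using coeffs_in_1[OF assms] by (metis poly_1)
  ultimately show ?thesis unfolding is_subring_def by fastforce
qed

text \<open>The Zorn form of Chevalley's extension theorem: \<open>u\<close> inside and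
  \<open>inverse u\<close> outside make \<open>u\<close> a nonunit, and maximality will turn the
  ring into a valuation ring.\<close>

locale maximal_subring_avoiding =
  fixes R :: "'a::field set" and u :: 'a
  assumes subring: "is_subring R"
    and u_in: "u \<in> R"
    and inverse_u_notin: "inverse u \<notin> R"
    and maximal: "\<And>R'. is_subring R' \<Longrightarrow> R \<subseteq> R' \<Longrightarrow> inverse u \<notin> R' \<Longrightarrow> R' = R"
begin

lemmas ring_closed = is_subring_0[OF subring] is_subring_1[OF subring] is_subring_add[OF subring]
  is_subring_diff[OF subring] is_subring_mult[OF subring] is_subring_uminus[OF subring]

lemma u_nonzero: "u \<noteq> 0"
  using inverse_u_notin ring_closed(1) by auto

lemma one_minus_nonzero:
  assumes "r \<in> R"
  shows "1 - u * r \<noteq> 0"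
proof
  assume "1 - u * r = 0"
  then have "inverse u = r" using inverse_unique by simp
  then show False using assms inverse_u_notin by simp
qed

text \<open>Otherwise localising at \<open>1 + uR\<close> would enlarge \<open>R\<close> without inverting \<open>u\<close>.\<close>

lemma one_minus_inverse:
  assumes "r \<in> R"
  shows "inverse (1 - u * r) \<in> R"
proof -
  define R' where "R' = {a / (1 - u * r) | a r. a \<in> R \<and> r \<in> R}"
  have R'I: "a / (1 - u * r) \<in> R'" if "a \<in> R" "r \<in> R" for a r
    using that unfolding R'_def by blast
  have "is_subring R'"
    unfolding is_subring_def
  proof (intro conjI ballI)
    show "1 \<in> R'" using R'I[of 1 0] by (simp add: ring_closed)
    fix x y assume "x \<in> R'" "y \<in> R'"
    then obtain a r b s where x: "x = a / (1 - u * r)" "a \<in> R" "r \<in> R"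
      and y: "y = b / (1 - u * s)" "b \<in> R" "s \<in> R"
      unfolding R'_def by blast
    let ?t = "r + s - u * (r * s)"
    have t: "(1 - u * r) * (1 - u * s) = 1 - u * ?t" by (simp add: algebra_simps)
    have tR: "?t \<in> R" using x y u_in by (simp add: ring_closed)
    have nz: "1 - u * r \<noteq> 0" "1 - u * s \<noteq> 0" using one_minus_nonzero x y by auto
    have "x - y = (a * (1 - u * s) - b * (1 - u * r)) / (1 - u * ?t)"
      unfolding x(1) y(1) t[symmetric] using nz by (simp add: diff_frac_eq)
    also have "\<dots> \<in> R'" using x y u_in tR by (intro R'I) (simp_all add: ring_closed)
    finally show "x - y \<in> R'" .
    have "x * y = (a * b) / (1 - u * ?t)" unfolding x(1) y(1) t[symmetric] by simp
    also have "\<dots> \<in> R'" using x y tR by (intro R'I) (simp_all add: ring_closed)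
    finally show "x * y \<in> R'" .
  qed
  moreover have "R \<subseteq> R'"
  proof
    fix a assume "a \<in> R"
    then show "a \<in> R'" using R'I[of a 0] by (simp add: ring_closed)
  qed
  moreover have "inverse u \<notin> R'"
  proof
    assume "inverse u \<in> R'"
    then obtain a r where ar: "inverse u = a / (1 - u * r)" "a \<in> R" "r \<in> R"
      unfolding R'_def by blast
    then have "inverse u * (1 - u * r) = a"
      using one_minus_nonzero[of r] by simp
    then have "inverse u = a + r" using u_nonzero by (simp add: algebra_simps)
    then show False using ar inverse_u_notin ring_closed by metis
  qed
  ultimately have "R' = R" by (rule maximal)
  then show ?thesis using R'I[of 1 r] assms by (simp add: ring_closed divide_inverse)
qed

text \<open>The ring R[x] properly contains R, so maximality forces \<open>inverse u\<close> into
  it.\<close>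

lemma inverse_u_in_adjunction:
  assumes "x \<notin> R"
  shows "\<exists>f. coeffs_in R f \<and> poly f x = inverse u"
proof (rule ccontr)
  assume none: "\<not> ?thesis"
  let ?R' = "{poly f x | f. coeffs_in R f}"
  have "?R' = R"
  proof (rule maximal)
    show "is_subring ?R'" by (rule is_subring_poly_values[OF subring])
    show "R \<subseteq> ?R'"
    proof
      fix a assume "a \<in> R"
      then show "a \<in> ?R'"
        by (intro CollectI exI[of _ "[:a:]"]) (simp add: coeffs_in_pCons_iff coeffs_in_0 ring_closed)
    qed
    show "inverse u \<notin> ?R'" using none by force
  qed
  moreover have "x \<in> ?R'"
    by (intro CollectI exI[of _ "[:0, 1:]"]) (simp add: coeffs_in_pCons_iff coeffs_in_0 ring_closed)
  ultimately show False using assms by simp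
qed

text \<open>Multiplying the relation in 1/x by u x^m, with m the degree of \<open>g\<close> and g0
  its constant term, expresses (1 - u g0) x^m through lower powers of x. Since 1 - u g0 is a unit of
  R, x^m can be eliminated from the top term of \<open>f\<close>.\<close>

lemma relation_degree_decrease:
  assumes x: "x \<noteq> 0"
    and f: "coeffs_in R f" "poly f x = inverse u"
    and g: "coeffs_in R g" "poly g (inverse x) = inverse u"
    and deg: "degree g \<le> degree f"
  shows "\<exists>f'. coeffs_in R f' \<and> poly f' x = inverse u \<and> degree f' < degree f"
proof -
  define m n where "m = degree g" and "n = degree f"
  have "m \<noteq> 0"
  proof
    assume "m = 0"
    then obtain c where "g = [:c:]" unfolding m_def by (rule degree_eq_zeroE)
    then show False using g inverse_u_notin by (simp add: coeffs_in_pCons_iff)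
  qed
  define g0 where "g0 = coeff g 0"
  have g0: "g0 \<in> R" using g by (simp add: g0_def coeffs_in_def)
  define h' where "h' = reflect_poly g - monom g0 m"
  have "coeffs_in R (reflect_poly g)"
    using g(1) ring_closed by (simp add: coeffs_in_def coeff_reflect_poly)
  then have h'_in: "coeffs_in R h'"
    unfolding h'_def using g0 by (intro coeffs_in_diff coeffs_in_monom subring)
  have h'_deg: "degree h' \<le> m - 1"
  proof (rule degree_le, intro allI impI)
    fix i assume "m - 1 < i"
    then have "m \<le> i" by simp
    then show "coeff h' i = 0"
      by (cases "i = m") (simp_all add: h'_def coeff_reflect_poly g0_def m_def)
  qed
  define e where "e = 1 - u * g0"
  have e: "e \<noteq> 0" "inverse e \<in> R"
    using one_minus_nonzero one_minus_inverse g0 by (auto simp: e_def)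
  have "poly (reflect_poly g) x = x ^ m * inverse u"
    using x g(2) by (simp add: poly_reflect_poly_nz m_def)
  then have "u * poly h' x = x ^ m * e"
    using u_nonzero by (simp add: h'_def e_def poly_monom algebra_simps)
  then have pow: "x ^ m = inverse e * (u * poly h' x)" using e(1) by (simp add: field_simps)
  define h where "h = smult (inverse e * u) h'"
  have h: "coeffs_in R h" "poly h x = x ^ m" "degree h \<le> m - 1"
    using h'_in h'_deg e(2) u_in pow
    by (auto simp: h_def ring_closed mult.assoc intro!: coeffs_in_smult[OF subring] ring_closed)
  define c where "c = coeff f n"
  have c: "c \<in> R" using f by (simp add: c_def coeffs_in_def)
  \<comment> \<open>The leading term c x^n becomes c x^(n - m) times the expression \<open>h\<close>
    for x^m, whose degree is below m.\<close>
  define f' where "f' = (f - monom c n) + monom c (n - m) * h"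
  have "coeffs_in R f'"
    unfolding f'_def using c f(1) h(1) subring
    by (intro coeffs_in_add coeffs_in_diff coeffs_in_mult coeffs_in_monom)
  moreover have "poly f' x = inverse u"
  proof -
    have "x ^ (n - m) * x ^ m = x ^ n" using deg by (simp add: m_def n_def flip: power_add)
    then show ?thesis using f(2) h(2) by (simp add: f'_def poly_monom mult.assoc)
  qed
  moreover have "degree f' < n"
  proof -
    have "degree (f - monom c n) \<le> n - 1"
    proof (rule degree_le, intro allI impI)
      fix i assume "n - 1 < i"
      then have "n \<le> i" by simp
      then show "coeff (f - monom c n) i = 0"
        by (cases "i = n") (simp_all add: c_def n_def coeff_eq_0)
    qed
    moreover have "degree (monom c (n - m) * h) \<le> n - 1"
      using degree_mult_le[of "monom c (n - m)" h] degree_monom_le[of c "n - m"] h(3) deg \<open>m \<noteq> 0\<close>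
      unfolding m_def n_def by linarith
    ultimately have "degree f' \<le> n - 1" unfolding f'_def by (rule degree_add_le)
    then show ?thesis using deg \<open>m \<noteq> 0\<close> by (simp add: m_def n_def)
  qed
  ultimately show ?thesis unfolding n_def by blast
qed

text \<open>Descent on the sum of the degrees: the relation of larger degree can be shortened, and
  exchanging \<open>x\<close> with its inverse exchanges the roles of \<open>f\<close> and
  \<open>g\<close>.\<close>

lemma no_simultaneous_relations:
  assumes "x \<noteq> 0" "coeffs_in R f" "poly f x = inverse u"
    "coeffs_in R g" "poly g (inverse x) = inverse u"
  shows False
  using assms
proof (induction "degree f + degree g" arbitrary: f g rule: less_induct)
  case less
  show False
  proof (cases "degree g \<le> degree f")
    case True
    then obtain f' where "coeffs_in R f'" "poly f' x = inverse u" "degree f' < degree f"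
      using relation_degree_decrease less.prems by blast
    then show False using less.hyps[of f' g] less.prems by simp
  next
    case False
    then obtain g' where "coeffs_in R g'" "poly g' (inverse x) = inverse u" "degree g' < degree g"
      using relation_degree_decrease[of "inverse x" g f] less.prems by auto
    then show False using less.hyps[of f g'] less.prems by simp
  qed
qed

lemma valuation_property: "x \<in> R \<or> inverse x \<in> R"
proof (rule ccontr)
  assume "\<not> ?thesis"
  then have x: "x \<notin> R" "inverse x \<notin> R" by auto
  then have "x \<noteq> 0" using ring_closed(1) by auto
  then show False
    using inverse_u_in_adjunction[OF x(1)] inverse_u_in_adjunction[OF x(2)]
      no_simultaneous_relations by blast
qed

end

text \<open>Zorn's lemma has a starting point in F_p[u]: if 1/u were f(u), then u would be a root of
  X f(X) - 1 and hence constant.\<close>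

lemma ex_maximal_subring_avoiding:
  fixes u :: "'a::field"
  assumes p: "prime CHAR('a)" and u: "u \<notin> constant_field"
  shows "\<exists>R. maximal_subring_avoiding R u"
proof -
  let ?F = "prime_subfield :: 'a set"
  note F = is_subring_prime_subfield[OF p]
  let ?\<A> = "{A. is_subring A \<and> u \<in> A \<and> inverse u \<notin> A}"
  let ?A = "{poly f u | f. coeffs_in ?F f}"
  have u0: "u \<noteq> 0" using u zero_in_constant_field[OF p] by metis
  have "inverse u \<notin> ?A"
  proof
    assume "inverse u \<in> ?A"
    then obtain f where f: "inverse u = poly f u" "coeffs_in ?F f" by blast
    have "poly (pCons (-1) f) u = 0" using u0 by (simp flip: f(1))
    moreover have "coeffs_in ?F (pCons (-1) f)"
      using f is_subring_uminus[OF F is_subring_1[OF F]] by (simp add: coeffs_in_pCons_iff)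
    moreover have "pCons (-1) f \<noteq> 0" by simp
    ultimately show False using u unfolding constant_field_def by blast
  qed
  moreover have "u \<in> ?A"
    by (intro CollectI exI[of _ "[:0, 1:]"])
      (simp add: coeffs_in_pCons_iff coeffs_in_0 is_subring_0[OF F] is_subring_1[OF F])
  ultimately have "?A \<in> ?\<A>" using is_subring_poly_values[OF F] by blast
  then have ne: "?\<A> \<noteq> {}" by blast
  have "\<exists>M\<in>?\<A>. \<forall>X\<in>?\<A>. M \<subseteq> X \<longrightarrow> X = M"
  proof (rule subset_Zorn_nonempty[OF ne])
    fix \<C> assume C: "\<C> \<noteq> {}" "subset.chain ?\<A> \<C>"
    then have mem: "\<And>A. A \<in> \<C> \<Longrightarrow> is_subring A \<and> u \<in> A \<and> inverse u \<notin> A"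
      and lin: "\<And>A B. A \<in> \<C> \<Longrightarrow> B \<in> \<C> \<Longrightarrow> A \<subseteq> B \<or> B \<subseteq> A"
      unfolding subset.chain_def by blast+
    have "is_subring (\<Union>\<C>)"
      unfolding is_subring_def
    proof (intro conjI ballI)
      show "1 \<in> \<Union>\<C>" using C(1) mem is_subring_1 by blast
      fix x y assume "x \<in> \<Union>\<C>" "y \<in> \<Union>\<C>"
      then obtain A where A: "A \<in> \<C>" "x \<in> A" "y \<in> A" using lin by blast
      then have "x - y \<in> A" "x * y \<in> A" using mem is_subring_diff is_subring_mult by blast+
      then show "x - y \<in> \<Union>\<C>" "x * y \<in> \<Union>\<C>" using A by blast+
    qed
    then show "\<Union>\<C> \<in> ?\<A>" using mem C(1) by blast
  qed
  then obtain M where M: "is_subring M" "u \<in> M" "inverse u \<notin> M"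
    and max: "\<And>X. is_subring X \<Longrightarrow> M \<subseteq> X \<Longrightarrow> inverse u \<notin> X \<Longrightarrow> X = M"
    by blast
  have "maximal_subring_avoiding M u"
    by unfold_locales (use M max in auto)
  then show ?thesis by blast
qed

section \<open>Discreteness\<close>

text \<open>\<open>R\<close> may still be the whole field; nontriviality enters later through a
  nonzero element of the maximal ideal.\<close>

locale valuation_subring = finite_over_rational_functions t B
  for t :: "'a::field" and B :: "'a set" +
  fixes R :: "'a set"
  assumes subring: "is_subring R"
    and valuation_property: "\<And>x. x \<in> R \<or> inverse x \<in> R"
begin

lemmas ring_closed = is_subring_0[OF subring] is_subring_1[OF subring] is_subring_add[OF subring]
  is_subring_diff[OF subring] is_subring_mult[OF subring] is_subring_uminus[OF subring]

text \<open>\<open>inverse 0 = 0\<close> lies in \<open>R\<close>, hence the separate clause for 0.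
  All other elements lie in \<open>R\<close> by the valuation property.\<close>

definition max_ideal :: "'a set" where
  "max_ideal = {x. x = 0 \<or> inverse x \<notin> R}"

definition unit_in :: "'a \<Rightarrow> bool" where
  "unit_in x \<longleftrightarrow> x \<noteq> 0 \<and> x \<in> R \<and> inverse x \<in> R"

lemma max_ideal_subset: "x \<in> max_ideal \<Longrightarrow> x \<in> R"
  using valuation_property[of x] ring_closed by (auto simp: max_ideal_def)

lemma unit_or_max_ideal: "x \<in> R \<Longrightarrow> unit_in x \<or> x \<in> max_ideal"
  by (auto simp: unit_in_def max_ideal_def)

lemma not_unit_max_ideal: "x \<in> max_ideal \<Longrightarrow> \<not> unit_in x"
  by (auto simp: unit_in_def max_ideal_def)

lemma one_notin_max_ideal: "1 \<notin> max_ideal"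
  using ring_closed by (simp add: max_ideal_def)

lemma max_ideal_mult:
  assumes "x \<in> max_ideal" "r \<in> R"
  shows "x * r \<in> max_ideal"
proof (cases "x * r = 0")
  case False
  have "inverse (x * r) \<notin> R"
  proof
    assume "inverse (x * r) \<in> R"
    then have "inverse (x * r) * r \<in> R" using assms(2) by (rule ring_closed)
    also have "inverse (x * r) * r = inverse x" using False by (simp add: field_simps)
    finally show False using assms(1) False by (simp add: max_ideal_def)
  qed
  then show ?thesis by (simp add: max_ideal_def)
qed (simp add: max_ideal_def)

lemma unit_in_mult: "unit_in x \<Longrightarrow> unit_in y \<Longrightarrow> unit_in (x * y)"
  by (simp add: unit_in_def ring_closed)

lemma unit_in_inverse: "unit_in x \<Longrightarrow> unit_in (inverse x)"
  by (simp add: unit_in_def)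

lemma unit_in_1: "unit_in 1"
  by (simp add: unit_in_def ring_closed)

text \<open>If (1 - a)/a were in \<open>R\<close>, so would be (1 - a)/a + 1 = 1/a. Hence a/(1 - a)
  is in \<open>R\<close>, and adding 1 gives the inverse of 1 - a.\<close>

lemma unit_one_minus:
  assumes a: "a \<in> max_ideal"
  shows "unit_in (1 - a)"
proof -
  have nz: "1 - a \<noteq> 0" using a one_notin_max_ideal by auto
  have "inverse (1 - a) \<in> R"
  proof (cases "a = 0")
    case False
    have "(1 - a) / a \<notin> R"
    proof
      assume "(1 - a) / a \<in> R"
      then have "(1 - a) / a + 1 \<in> R" by (intro ring_closed)
      also have "(1 - a) / a + 1 = inverse a" using False by (simp add: field_simps)
      finally show False using a False by (simp add: max_ideal_def)
    qed
    then have "a / (1 - a) \<in> R" using valuation_property[of "(1 - a) / a"] by simp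
    then have "a / (1 - a) + 1 \<in> R" by (intro ring_closed)
    also have "a / (1 - a) + 1 = inverse (1 - a)" using nz by (simp add: field_simps)
    finally show ?thesis .
  qed (simp add: ring_closed)
  then show ?thesis
    using nz max_ideal_subset[OF a] by (simp add: unit_in_def ring_closed)
qed

text \<open>A chain of elements properly dividing \<open>z\<close> is pairwise incongruent modulo \<open>z\<close>:
  a difference of two of them is associate to one of the two.\<close>

lemma finite_divisor_chain:
  assumes z: "z \<noteq> 0" and A: "\<And>a. a \<in> A \<Longrightarrow> a \<noteq> 0 \<and> a \<in> R \<and> z / a \<in> max_ideal"
    and chain: "\<And>a b. a \<in> A \<Longrightarrow> b \<in> A \<Longrightarrow> a \<noteq> b \<Longrightarrow> a / b \<in> max_ideal \<or> b / a \<in> max_ideal"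
  shows "finite A"
proof (cases "A = {}")
  case False
  then obtain a where "a \<in> A" by blast
  then have "z / a * a \<in> R" using A max_ideal_subset by (blast intro: ring_closed)
  then have zR: "z \<in> R" using A[OF \<open>a \<in> A\<close>] by simp
  \<comment> \<open>Dividing the congruence by \<open>b\<close> equates the unit 1 - a/b with
    (z/b)(-r), an element of the maximal ideal.\<close>
  have aux: False if "a \<in> A" "b \<in> A" "a / b \<in> max_ideal" "r \<in> R" "a - b = z * r" for a b r
  proof -
    have ab: "a \<noteq> 0" "b \<noteq> 0" "z / b \<in> max_ideal" using A that by auto
    have u: "unit_in (1 - a / b)" using that(3) by (rule unit_one_minus)
    have "(1 - a / b) = z / b * (- r)" using ab that(5) by (simp add: field_simps)
    moreover have "z / b * (- r) \<in> max_ideal" using ab that by (intro max_ideal_mult ring_closed)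
    ultimately show False using u not_unit_max_ideal by metis
  qed
  obtain M where M: "\<And>A' S. is_subring A' \<Longrightarrow> S \<subseteq> A' \<Longrightarrow> z \<in> A' \<Longrightarrow> z \<noteq> 0 \<Longrightarrow> finite S \<Longrightarrow>
       (\<And>s s' a. s \<in> S \<Longrightarrow> s' \<in> S \<Longrightarrow> a \<in> A' \<Longrightarrow> s - s' = z * a \<Longrightarrow> s = s') \<Longrightarrow> card S \<le> M"
    by (rule incongruent_bound[of z]) blast
  have "card S \<le> M" if S: "S \<subseteq> A" "finite S" for S
  proof (rule M[OF subring _ zR z S(2)])
    show "S \<subseteq> R" using S A by blast
    fix s s' a assume s: "s \<in> S" "s' \<in> S" "a \<in> R" "s - s' = z * a"
    show "s = s'"
    proof (rule ccontr)
      assume "s \<noteq> s'"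
      then consider "s / s' \<in> max_ideal" | "s' / s \<in> max_ideal" using chain s S by blast
      then show False
      proof cases
        case 1
        then show False using aux[of s s' a] s S by blast
      next
        case 2
        have "s' - s = z * (- a)" using s(4) by (simp add: algebra_simps)
        then show False using aux[of s' s "- a"] 2 s S ring_closed(6) by blast
      qed
    qed
  qed
  then show ?thesis using finite_if_finite_subsets_card_bdd by blast
qed simp

text \<open>If nothing generated the maximal ideal, each nonzero element of it would have a proper
  divisor that is again in the ideal; iterating from \<open>z\<close> yields an infinite chain of
  divisors of \<open>z\<close>.\<close>

lemma ex_uniformizer:
  assumes z: "z \<noteq> 0" "z \<in> max_ideal"
  shows "\<exists>\<pi>. \<pi> \<noteq> 0 \<and> \<pi> \<in> max_ideal \<and> (\<forall>a\<in>max_ideal. a / \<pi> \<in> R)"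
proof (rule ccontr)
  assume none: "\<not> ?thesis"
  have divisor: "\<exists>a. a \<noteq> 0 \<and> a \<in> max_ideal \<and> x / a \<in> max_ideal"
    if x: "x \<noteq> 0" "x \<in> max_ideal" for x
  proof -
    obtain a where a: "a \<in> max_ideal" "a / x \<notin> R" using none x by blast
    then have "a \<noteq> 0" using ring_closed(1) by auto
    moreover have "x / a \<in> max_ideal" using a by (simp add: max_ideal_def)
    ultimately show ?thesis using a by blast
  qed
  define P where "P = (\<lambda>(n::nat) x. x \<noteq> 0 \<and> x \<in> max_ideal \<and> z / x \<in> max_ideal)"
  have "\<exists>f. \<forall>n. P n (f n) \<and> f n / f (Suc n) \<in> max_ideal"
  proof (rule dependent_nat_choice)
    show "\<exists>x. P 0 x" using divisor[OF z] by (simp add: P_def)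
    fix x n assume x: "P n x"
    then obtain y where y: "y \<noteq> 0" "y \<in> max_ideal" "x / y \<in> max_ideal"
      using divisor[of x] by (auto simp: P_def)
    have "z / x * (x / y) \<in> max_ideal"
      using x y max_ideal_subset by (intro max_ideal_mult) (auto simp: P_def)
    then have "z / y \<in> max_ideal" using x by (simp add: P_def)
    then show "\<exists>y. P (Suc n) y \<and> x / y \<in> max_ideal" using y by (auto simp: P_def)
  qed
  then obtain f where f: "\<And>n. P n (f n)" "\<And>n. f n / f (Suc n) \<in> max_ideal" by blast
  have less: "f i / f j \<in> max_ideal" if "i < j" for i j
    using that
  proof (induction j)
    case (Suc j)
    show ?case
    proof (cases "i = j")
      case False
      then have "f i / f j * (f j / f (Suc j)) \<in> max_ideal"
        using Suc f(2) max_ideal_subset by (intro max_ideal_mult) auto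
      then show ?thesis using f(1)[of j] by (simp add: P_def)
    qed (use f(2) in simp)
  qed simp
  have "inj f"
  proof (rule linorder_injI)
    fix i j :: nat assume "i < j"
    then show "f i \<noteq> f j" using less[of i j] f(1)[of j] one_notin_max_ideal by (auto simp: P_def)
  qed
  moreover have "finite (range f)"
  proof (rule finite_divisor_chain[OF z(1)])
    fix a assume "a \<in> range f"
    then show "a \<noteq> 0 \<and> a \<in> R \<and> z / a \<in> max_ideal"
      using f(1) max_ideal_subset by (auto simp: P_def)
  next
    fix a b assume "a \<in> range f" "b \<in> range f" "a \<noteq> b"
    then obtain i j where "a = f i" "b = f j" "i \<noteq> j" by blast
    then show "a / b \<in> max_ideal \<or> b / a \<in> max_ideal"
      using less by (metis linorder_neqE_nat)
  qed
  ultimately show False using finite_imageD by blast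
qed

lemma ex_place:
  assumes z: "z \<noteq> 0" "z \<in> max_ideal"
  shows "\<exists>v. is_place v \<and> (\<forall>x. x \<noteq> 0 \<longrightarrow> v x \<ge> 0 \<longleftrightarrow> x \<in> R)"
proof -
  obtain \<pi> where \<pi>: "\<pi> \<noteq> 0" "\<pi> \<in> max_ideal" and div: "\<And>a. a \<in> max_ideal \<Longrightarrow> a / \<pi> \<in> R"
    using ex_uniformizer[OF z] by blast
  note \<pi>R = max_ideal_subset[OF \<pi>(2)]
  have pow: "\<pi> ^ n \<in> max_ideal" if "n > 0" for n
  proof -
    have "\<pi> * \<pi> ^ (n - 1) \<in> max_ideal"
      using \<pi> \<pi>R by (intro max_ideal_mult is_subring_power subring)
    then show ?thesis using that by (metis power_minus_mult mult.commute)
  qed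
  \<comment> \<open>If dividing out powers of \<open>\<pi>\<close> never left a unit, all the powers
    would be proper divisors of \<open>x\<close> and form an infinite chain.\<close>
  have nat_exp: "\<exists>k::nat. unit_in (x / \<pi> ^ k)" if x: "x \<noteq> 0" "x \<in> R" for x
  proof (rule ccontr)
    assume none: "\<not> ?thesis"
    have inR: "x / \<pi> ^ k \<in> R" for k
    proof (induction k)
      case (Suc k)
      then have "x / \<pi> ^ k \<in> max_ideal" using none unit_or_max_ideal by blast
      from div[OF this] show ?case by (simp add: mult.commute)
    qed (use x in simp)
    have inM: "x / \<pi> ^ k \<in> max_ideal" for k using none inR unit_or_max_ideal by blast
    have less: "\<pi> ^ j / \<pi> ^ i \<in> max_ideal" if "i < j" for i j
      using pow[of "j - i"] that \<pi>(1) by (simp add: power_diff)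
    have "inj (\<lambda>k. \<pi> ^ k)"
    proof (rule linorder_injI)
      fix i j :: nat assume "i < j"
      then show "\<pi> ^ i \<noteq> \<pi> ^ j" using less[of i j] \<pi>(1) one_notin_max_ideal by auto
    qed
    moreover have "finite (range (\<lambda>k. \<pi> ^ k))"
    proof (rule finite_divisor_chain[OF x(1)])
      fix a assume "a \<in> range (\<lambda>k. \<pi> ^ k)"
      then show "a \<noteq> 0 \<and> a \<in> R \<and> x / a \<in> max_ideal"
        using inM \<pi> \<pi>R is_subring_power[OF subring] by auto
    next
      fix a b assume "a \<in> range (\<lambda>k. \<pi> ^ k)" "b \<in> range (\<lambda>k. \<pi> ^ k)" "a \<noteq> b"
      then obtain i j where "a = \<pi> ^ i" "b = \<pi> ^ j" "i \<noteq> j" by blast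
      then show "a / b \<in> max_ideal \<or> b / a \<in> max_ideal"
        using less by (metis linorder_neqE_nat)
    qed
    ultimately show False using finite_imageD by blast
  qed
  have int_exp: "\<exists>k::int. unit_in (x / \<pi> powi k)" if x: "x \<noteq> 0" for x
  proof (cases "x \<in> R")
    case True
    then obtain k where "unit_in (x / \<pi> ^ k)" using nat_exp x by blast
    then show ?thesis by (intro exI[of _ "int k"]) simp
  next
    case False
    then have "inverse x \<in> R" using valuation_property by blast
    then obtain k where "unit_in (inverse x / \<pi> ^ k)" using nat_exp[of "inverse x"] x by auto
    then have "unit_in (inverse (inverse x / \<pi> ^ k))" by (rule unit_in_inverse)
    then show ?thesis
      by (intro exI[of _ "- int k"]) (simp add: power_int_minus divide_inverse mult.commute)
  qed
  have pos_not_unit: "\<not> unit_in (\<pi> powi k)" if "k > 0" for k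
    using pow[of "nat k"] that not_unit_max_ideal by (simp add: power_int_def)
  have unit_powi: "k = 0" if "unit_in (\<pi> powi k)" for k
  proof (rule ccontr)
    assume "k \<noteq> 0"
    then consider "k > 0" | "- k > 0" by linarith
    then show False
    proof cases
      case 2
      have "unit_in (\<pi> powi (- k))" using unit_in_inverse[OF that] by (simp add: power_int_minus)
      then show False using pos_not_unit 2 by blast
    qed (use pos_not_unit that in blast)
  qed
  define v where "v = (\<lambda>x. if x = 0 then 0 else THE k::int. unit_in (x / \<pi> powi k))"
  have unique: "k = l" if "unit_in (x / \<pi> powi k)" "unit_in (x / \<pi> powi l)" for x k l
  proof -
    have "x \<noteq> 0" using that by (auto simp: unit_in_def)
    then have "x / \<pi> powi k * inverse (x / \<pi> powi l) = \<pi> powi (l - k)"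
      using \<pi>(1) by (simp add: power_int_diff field_simps)
    then have "unit_in (\<pi> powi (l - k))" using unit_in_mult[OF that(1) unit_in_inverse[OF that(2)]] by simp
    then show ?thesis using unit_powi by fastforce
  qed
  have v_eq: "v x = k" if "unit_in (x / \<pi> powi k)" for x k
  proof -
    have "x \<noteq> 0" using that by (auto simp: unit_in_def)
    then show ?thesis using that unique by (auto simp: v_def)
  qed
  have v_unit: "unit_in (x / \<pi> powi v x)" if "x \<noteq> 0" for x
    using int_exp[OF that] v_eq by auto
  have v_mult: "v (x * y) = v x + v y" if "x \<noteq> 0" "y \<noteq> 0" for x y
  proof (rule v_eq)
    have "unit_in (x / \<pi> powi v x * (y / \<pi> powi v y))"
      using v_unit that by (intro unit_in_mult) auto
    then show "unit_in (x * y / \<pi> powi (v x + v y))" using \<pi>(1) by (simp add: power_int_add)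
  qed
  have v_pi: "v (\<pi> powi k) = k" for k
    using v_eq[of "\<pi> powi k" k] \<pi>(1) unit_in_1 by simp
  have v_ring: "v x \<ge> 0 \<longleftrightarrow> x \<in> R" if x: "x \<noteq> 0" for x
  proof
    assume "v x \<ge> 0"
    then have "\<pi> powi v x \<in> R" using is_subring_power[OF subring \<pi>R] by (simp add: power_int_def)
    then have "x / \<pi> powi v x * \<pi> powi v x \<in> R" using v_unit[OF x] by (intro ring_closed) (auto simp: unit_in_def)
    then show "x \<in> R" using \<pi>(1) by simp
  next
    assume xR: "x \<in> R"
    show "v x \<ge> 0"
    proof (rule ccontr)
      assume neg: "\<not> v x \<ge> 0"
      then have "\<pi> powi (- v x) \<in> max_ideal" using pow[of "nat (- v x)"] by (simp add: power_int_def)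
      then have "\<pi> powi (- v x) * x \<in> max_ideal" using xR by (rule max_ideal_mult)
      then have "x / \<pi> powi v x \<in> max_ideal" by (simp add: power_int_minus field_simps)
      then show False using v_unit[OF x] not_unit_max_ideal by blast
    qed
  qed
  \<comment> \<open>After division by the summand of smaller valuation, the point is that 1 + y/x
    lies in \<open>R\<close>.\<close>
  have v_add_aux: "v (x + y) \<ge> v x"
    if xy: "x \<noteq> 0" "y \<noteq> 0" "x + y \<noteq> 0" and le: "v x \<le> v y" for x y
  proof -
    have "v y = v x + v (y / x)" using v_mult[of x "y / x"] xy by simp
    then have "y / x \<in> R" using v_ring[of "y / x"] xy le by simp
    then have "(x + y) / x \<in> R" using xy ring_closed(3)[OF ring_closed(2), of "y / x"]
      by (simp add: add_divide_distrib)
    then have "v ((x + y) / x) \<ge> 0" using v_ring xy by simp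
    moreover have "v (x + y) = v x + v ((x + y) / x)" using v_mult[of x "(x + y) / x"] xy by simp
    ultimately show ?thesis by simp
  qed
  have v_add: "v (x + y) \<ge> min (v x) (v y)" if "x \<noteq> 0" "y \<noteq> 0" "x + y \<noteq> 0" for x y
    using v_add_aux[of x y] v_add_aux[of y x] that by (cases "v x \<le> v y") (auto simp: add.commute)
  have v_surj: "v ` (UNIV - {0}) = UNIV"
  proof -
    have "k \<in> v ` (UNIV - {0})" for k
      using v_pi[of k] \<pi>(1) by (intro image_eqI[of _ _ "\<pi> powi k"]) auto
    then show ?thesis by blast
  qed
  have "is_place v"
    unfolding is_place_def using v_mult v_add v_surj by (simp add: v_def)
  then show ?thesis using v_ring by blast
qed

end

lemma (in finite_over_rational_functions) ex_place_positive:
  fixes u :: 'a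
  assumes "u \<notin> constant_field"
  shows "\<exists>v. is_place v \<and> v u > 0"
proof -
  obtain R where "maximal_subring_avoiding R u"
    using ex_maximal_subring_avoiding[OF prime_char assms] by blast
  then interpret max: maximal_subring_avoiding R u .
  interpret valuation_subring t B R
    by unfold_locales (use max.subring max.valuation_property in auto)
  have "u \<in> max_ideal" using max.inverse_u_notin by (simp add: max_ideal_def)
  then obtain v where v: "is_place v" "\<And>x. x \<noteq> 0 \<Longrightarrow> v x \<ge> 0 \<longleftrightarrow> x \<in> R"
    using ex_place[OF max.u_nonzero] by blast
  have add: "v (x * y) = v x + v y" if "x \<noteq> 0" "y \<noteq> 0" for x y
    using v(1) that unfolding is_place_def by blast
  have "v (u * inverse u) = v u + v (inverse u)" and "v (1 * 1) = v 1 + v 1"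
    using add[of u "inverse u"] add[of 1 1] max.u_nonzero by auto
  moreover have "\<not> v (inverse u) \<ge> 0" using v(2) max.inverse_u_notin max.u_nonzero by simp
  ultimately have "v u > 0" using max.u_nonzero by simp
  then show ?thesis using v(1) by blast
qed

section \<open>Places and periodic points\<close>

lemma
  assumes "is_place v"
  shows place_mult: "x \<noteq> 0 \<Longrightarrow> y \<noteq> 0 \<Longrightarrow> v (x * y) = v x + v y"
    and place_add: "x \<noteq> 0 \<Longrightarrow> y \<noteq> 0 \<Longrightarrow> x + y \<noteq> 0 \<Longrightarrow> v (x + y) \<ge> min (v x) (v y)"
    and place_1: "v 1 = 0"
    and place_uminus: "v (- x) = v x"
    and place_inverse: "v (inverse x) = - v x"
    and place_power: "x \<noteq> 0 \<Longrightarrow> v (x ^ n) = int n * v x"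
proof -
  show m: "x \<noteq> 0 \<Longrightarrow> y \<noteq> 0 \<Longrightarrow> v (x * y) = v x + v y" for x y
    using assms unfolding is_place_def by blast
  show "x \<noteq> 0 \<Longrightarrow> y \<noteq> 0 \<Longrightarrow> x + y \<noteq> 0 \<Longrightarrow> v (x + y) \<ge> min (v x) (v y)"
    using assms unfolding is_place_def by blast
  have 0: "v 0 = 0" using assms unfolding is_place_def by blast
  show 1: "v 1 = 0" using m[of 1 1] by simp
  have "v (- 1) = 0" using m[of "-1" "-1"] 1 by simp
  then show "v (- x) = v x" using m[of "-1" x] by (cases "x = 0") auto
  show "v (inverse x) = - v x" using m[of x "inverse x"] 0 1 by (cases "x = 0") auto
  show "x \<noteq> 0 \<Longrightarrow> v (x ^ n) = int n * v x"
    by (induction n) (auto simp: 1 m algebra_simps)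
qed

definition place_ring :: "('a::field \<Rightarrow> int) \<Rightarrow> 'a set" where
  "place_ring v = {x. x = 0 \<or> v x \<ge> 0}"

lemma is_subring_place_ring:
  assumes v: "is_place v"
  shows "is_subring (place_ring v)"
proof -
  have "x - y \<in> place_ring v" if xy: "x \<in> place_ring v" "y \<in> place_ring v" for x y
  proof (cases "x = 0 \<or> y = 0 \<or> x - y = 0")
    case False
    then show ?thesis
      using place_add[OF v, of x "- y"] xy by (auto simp: place_ring_def place_uminus[OF v])
  qed (use xy in \<open>auto simp: place_ring_def place_uminus[OF v]\<close>)
  moreover have "x * y \<in> place_ring v" if "x \<in> place_ring v" "y \<in> place_ring v" for x y
    using that place_mult[OF v, of x y]
    by (cases "x = 0 \<or> y = 0") (auto simp: place_ring_def)
  ultimately show ?thesis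
    unfolding is_subring_def using place_1[OF v] by (simp add: place_ring_def)
qed

text \<open>Presents O as an intersection of local rings, so that integrality and divisibility can
  be treated one place at a time.\<close>

lemma ring_O_eq: "ring_O vinf = {x. \<forall>v. is_place v \<longrightarrow> v \<noteq> vinf \<longrightarrow> x \<in> place_ring v}"
  by (auto simp: ring_O_def place_ring_def)

text \<open>The reverse estimate comes from the ultrametric inequality for b = (a + b) - a.\<close>

lemma place_add_dominant:
  assumes v: "is_place v" and a: "a \<in> place_ring v" and b: "b \<noteq> 0" "v b < 0"
  shows "a + b \<noteq> 0 \<and> v (a + b) = v b"
proof (cases "a = 0")
  case False
  then have va: "v a \<ge> 0" using a by (simp add: place_ring_def)
  have nz: "a + b \<noteq> 0"
  proof
    assume "a + b = 0"
    then have "b = - a" by (simp add: eq_neg_iff_add_eq_0 add.commute)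
    then show False using va b place_uminus[OF v] by simp
  qed
  have "v (a + b) \<ge> v b" using place_add[OF v False b(1) nz] va b by simp
  moreover have "v b \<ge> min (v (a + b)) (v a)"
    using place_add[OF v, of "a + b" "- a"] nz False b by (simp add: place_uminus[OF v])
  ultimately show ?thesis using nz va b by simp
qed (use b in simp)

text \<open>In the Horner step x f(x) has a pole, so adding the integral coefficient
  \<open>a\<close> leaves its order unchanged. The leading coefficient, of valuation 0, starts the
  induction.\<close>

lemma place_poly_pole:
  assumes v: "is_place v" and x: "x \<noteq> 0" "v x < 0"
    and f: "coeffs_in (place_ring v) f" "f \<noteq> 0" "v (lead_coeff f) = 0"
  shows "poly f x \<noteq> 0 \<and> v (poly f x) = int (degree f) * v x"
  using f
proof (induction f)
  case (pCons a f)
  show ?case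
  proof (cases "f = 0")
    case False
    have IH: "poly f x \<noteq> 0" "v (poly f x) = int (degree f) * v x"
      using pCons False by (auto simp: coeffs_in_pCons_iff)
    have deg: "v (x * poly f x) = int (Suc (degree f)) * v x"
      using place_mult[OF v x(1) IH(1)] IH(2) by (simp add: algebra_simps)
    moreover have "int (Suc (degree f)) * v x < 0" using x(2) by (simp add: mult_pos_neg)
    ultimately have "a + x * poly f x \<noteq> 0 \<and> v (a + x * poly f x) = v (x * poly f x)"
      using pCons.prems x IH by (intro place_add_dominant[OF v]) (auto simp: coeffs_in_pCons_iff)
    then show ?thesis using deg False by simp
  qed (use pCons.prems pCons.hyps in simp)
qed simp

lemma place_constant_field:
  fixes x :: "'a::field"
  assumes "prime CHAR('a)" "is_place v" "x \<in> constant_field" "x \<noteq> 0"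
  shows "v x = 0"
proof -
  obtain m where "m > 0" "x ^ m = 1" using constant_field_root_of_unity assms by blast
  then show ?thesis using place_power[OF assms(2,4), of m] place_1[OF assms(2)] by simp
qed

text \<open>Distinct constants stay distinct in the residue field of any place.\<close>

lemma (in finite_over_rational_functions) finite_constant_field:
  fixes v :: "'a \<Rightarrow> int"
  assumes v: "is_place v"
  shows "finite (constant_field :: 'a set)"
proof -
  \<comment> \<open>The modulus has valuation 1: its nonzero multiples in the place ring have
    positive valuation, whereas a nonzero difference of constants has valuation 0.\<close>
  have "1 \<in> v ` (UNIV - {0})" using v unfolding is_place_def by auto
  then obtain u where "1 = v u" "u \<in> UNIV - {0}" by (rule imageE)
  then have u: "u \<noteq> 0" "v u = 1" by auto
  obtain M where M: "\<And>A S. is_subring A \<Longrightarrow> S \<subseteq> A \<Longrightarrow> u \<in> A \<Longrightarrow> u \<noteq> 0 \<Longrightarrow> finite S \<Longrightarrow>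
       (\<And>s s' a. s \<in> S \<Longrightarrow> s' \<in> S \<Longrightarrow> a \<in> A \<Longrightarrow> s - s' = u * a \<Longrightarrow> s = s') \<Longrightarrow> card S \<le> M"
    by (rule incongruent_bound[of u]) blast
  have "card S \<le> M" if S: "S \<subseteq> constant_field" "finite S" for S :: "'a set"
  proof (rule M[OF is_subring_place_ring[OF v] _ _ u(1) S(2)])
    show "S \<subseteq> place_ring v"
      using S place_constant_field[OF prime_char v] by (force simp: place_ring_def)
    show "u \<in> place_ring v" using u by (simp add: place_ring_def)
    fix s s' a assume s: "s \<in> S" "s' \<in> S" "a \<in> place_ring v" "s - s' = u * a"
    show "s = s'"
    proof (rule ccontr)
      assume "s \<noteq> s'"
      then have "s - s' \<noteq> 0" by simp
      moreover have "s + (- s') \<in> constant_field"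
        using s S by (intro constant_field_add constant_field_minus prime_char) auto
      ultimately have "v (s - s') = 0" using place_constant_field[OF prime_char v] by simp
      moreover have "a \<noteq> 0" using \<open>s - s' \<noteq> 0\<close> s by auto
      ultimately show False
        using s place_mult[OF v u(1)] u(2) by (simp add: place_ring_def)
    qed
  qed
  then show ?thesis using finite_if_finite_subsets_card_bdd by blast
qed

text \<open>If \<open>u\<close> were not constant, both \<open>u\<close> and
  \<open>inverse u\<close> would have a zero. The hypothesis leaves only \<open>vinf\<close> for
  either, and one place cannot be a zero of both. This is where it matters that only a single place
  is exceptional.\<close>

lemma (in finite_over_rational_functions) constant_if_unit_outside:
  fixes u :: 'a
  assumes u: "\<And>v. is_place v \<Longrightarrow> v \<noteq> vinf \<Longrightarrow> v u = 0"
  shows "u \<in> constant_field"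
proof (rule ccontr)
  assume trans: "u \<notin> constant_field"
  have "inverse u \<notin> constant_field"
  proof
    assume "inverse u \<in> constant_field"
    then obtain k where "k \<ge> 1" "inverse u ^ (CHAR('a) ^ k) = inverse u"
      using constant_field_iff[OF prime_char] by blast
    then have "u ^ (CHAR('a) ^ k) = u" by (simp add: power_inverse)
    then show False using trans \<open>k \<ge> 1\<close> constant_field_iff[OF prime_char] by blast
  qed
  then obtain v w where vw: "is_place v" "v u > 0" "is_place w" "w (inverse u) > 0"
    using ex_place_positive trans by metis
  then have "w u < 0" by (simp add: place_inverse)
  then show False using u[of v] u[of w] vw by force
qed

section \<open>The orbit of a periodic point\<close>

lemma funpow_cong_fixed:
  assumes "(g ^^ n) x = x"
  shows "(g ^^ (m * n)) x = x"
  using assms by (induction m) (simp_all add: funpow_add)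

theorem theorem2p2:
  fixes vinf :: "'a::field \<Rightarrow> int" and \<phi> :: "'a poly" and x :: 'a
  assumes "global_function_field TYPE('a)"
    and "is_place vinf"
    and "coeffs_in (ring_O vinf) \<phi>"
    and "degree \<phi> \<ge> 2"
    and "lead_coeff \<phi> \<noteq> 0" and "inverse (lead_coeff \<phi>) \<in> ring_O vinf"
    and "periodic_pt (poly \<phi>) x"
  shows "x \<in> ring_O vinf \<and> minimal_period (poly \<phi>) x \<le> card (constant_field :: 'a set)"
proof -
  have p: "prime CHAR('a)" using assms(1) by (simp add: global_function_field_def)
  obtain t :: 'a and B where "finite B"
    "\<And>x. \<exists>c. (\<forall>b\<in>B. c b \<in> rat_fun_subfield t) \<and> x = (\<Sum>b\<in>B. c b * b)"
    using assms(1) unfolding global_function_field_def by blast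
  then interpret finite_over_rational_functions t B
    by unfold_locales (use p in auto)
  let ?C = "constant_field :: 'a set"
  let ?g = "poly \<phi>"
  define y where "y i = (?g ^^ i) x" for i
  define n where "n = minimal_period ?g x"
  have y_Suc: "y (Suc i) = ?g (y i)" and y_0: "y 0 = x" for i by (simp_all add: y_def)
  have "n \<ge> 1 \<and> (?g ^^ n) x = x"
    unfolding n_def minimal_period_def
    by (rule LeastI_ex) (use assms(7) in \<open>auto simp: periodic_pt_def\<close>)
  then have n: "n \<ge> 1" "(?g ^^ n) x = x" by auto
  have n_min: "n \<le> m" if "m \<ge> 1" "(?g ^^ m) x = x" for m
    unfolding n_def minimal_period_def using that by (intro Least_le) auto
  have y_mult: "y (m * n) = x" for m
    unfolding y_def by (rule funpow_cong_fixed[OF n(2)])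
  have y_period: "y (i + m * n) = y i" for i m
    using y_mult[of m] by (simp add: y_def funpow_add)
  have coeffs_v: "coeffs_in (place_ring v) \<phi>" if "is_place v" "v \<noteq> vinf" for v
    using assms(3) that by (auto simp: coeffs_in_def ring_O_eq)
  have lead_v: "v (lead_coeff \<phi>) = 0" if v: "is_place v" "v \<noteq> vinf" for v
  proof -
    have "lead_coeff \<phi> \<in> place_ring v" "inverse (lead_coeff \<phi>) \<in> place_ring v"
      using assms(3,6) v by (auto simp: coeffs_in_def ring_O_eq)
    then show ?thesis using assms(5) by (auto simp: place_ring_def place_inverse[OF v(1)])
  qed
  have x_v: "x \<in> place_ring v" if v: "is_place v" "v \<noteq> vinf" for v
  proof (rule ccontr)
    assume "x \<notin> place_ring v"
    then have x0: "x \<noteq> 0" "v x < 0" by (auto simp: place_ring_def)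
    \<comment> \<open>A bound weaker than doubling suffices: the order of the pole grows by at least
      1 per step, so it cannot be back at its initial value after \<open>n\<close> steps.\<close>
    have "y i \<noteq> 0 \<and> v (y i) \<le> v x - int i" for i
    proof (induction i)
      case (Suc i)
      then have neg: "y i \<noteq> 0" "v (y i) < 0" using x0 by auto
      have "y (Suc i) \<noteq> 0" "v (y (Suc i)) = int (degree \<phi>) * v (y i)"
        using place_poly_pole[OF v(1) neg coeffs_v[OF v] _ lead_v[OF v]] assms(5)
        by (auto simp: y_Suc)
      moreover have "int (degree \<phi>) * v (y i) \<le> 2 * v (y i)"
        using assms(4) neg(2) by (intro mult_right_mono_neg) auto
      ultimately show ?case using neg Suc by (intro conjI) linarith+
    qed (use x0 y_0 in simp)
    from this[of n] show False using n by (simp add: y_def)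
  qed
  have y_v: "y i \<in> place_ring v" if v: "is_place v" "v \<noteq> vinf" for v i
    by (induction i)
      (simp_all add: y_0 y_Suc x_v[OF v] poly_in_subring[OF is_subring_place_ring[OF v(1)] coeffs_v[OF v]])
  have x_O: "x \<in> ring_O vinf" using x_v by (simp add: ring_O_eq)
  have "n \<le> card ?C"
  \<comment> \<open>A fixed point has first difference 0, which leaves nothing to divide by. Even
    the bound 1 needs the constants to be finite, as an infinite set has \<open>card\<close>
    0.\<close>
  proof (cases "y 1 = x")
    case True
    then have "n \<le> 1" using n_min[of 1] by (simp add: y_def)
    moreover have "card ?C \<noteq> 0"
      using finite_constant_field[OF assms(2)] zero_in_constant_field[OF p] by auto
    ultimately show ?thesis by simp
  next
    case False
    define d where "d i = y (Suc i) - y i" for i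
    have d_nz: "d i \<noteq> 0" for i
    proof
      assume "d i = 0"
      then have "y (Suc i + j) = y (i + j)" for j
        by (induction j) (simp_all add: d_def y_Suc)
      \<comment> \<open>This shift moves the coincidence to a multiple of the period, where it reads
        \<open>y 1 = x\<close>; the subtraction is exact since n \<ge> 1.\<close>
      from this[of "i * n - i"] have "y (1 + i * n) = y (0 + i * n)"
        using n(1) by simp
      then show False using False unfolding y_period by (simp add: y_0)
    qed
    have d_le: "v (d i) \<le> v (d (Suc i))" if v: "is_place v" "v \<noteq> vinf" for v i
    proof -
      obtain w where w: "w \<in> place_ring v" "d (Suc i) = d i * w"
        using poly_diff_divisible[OF is_subring_place_ring[OF v(1)] coeffs_v[OF v] y_v[OF v] y_v[OF v],
            of "Suc i" i] by (auto simp: d_def y_Suc)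
      then have "w \<noteq> 0" using d_nz[of "Suc i"] by auto
      then show ?thesis using w place_mult[OF v(1) d_nz, of w i] by (simp add: place_ring_def)
    qed
    \<comment> \<open>A nondecreasing periodic sequence is constant: \<open>d (i * n) = d 0\<close>
      closes the chain of inequalities through \<open>d i\<close>.\<close>
    have d_eq: "v (d i) = v (d 0)" if v: "is_place v" "v \<noteq> vinf" for v i
    proof -
      have mono: "v (d i) \<le> v (d j)" if "i \<le> j" for i j
        using that d_le[OF v] by (rule lift_Suc_mono_le[rotated])
      have "d (i * n) = d 0"
        using y_period[of 0 i] y_period[of 1 i] by (simp add: d_def)
      moreover have "i \<le> i * n" using n(1) by simp
      ultimately show ?thesis using mono[of 0 i] mono[of i "i * n"] by simp
    qed
    have ratio: "d i / d 0 \<in> ?C" for i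
    proof (rule constant_if_unit_outside)
      fix v assume v: "is_place v" "v \<noteq> vinf"
      show "v (d i / d 0) = 0"
        using place_mult[OF v(1) d_nz, of "inverse (d 0)" i] d_nz[of 0] d_eq[OF v, of i]
        by (simp add: divide_inverse place_inverse[OF v(1)])
    qed
    have diff: "(y k - x) / d 0 \<in> ?C" for k
    proof (induction k)
      case (Suc k)
      have "(y (Suc k) - x) / d 0 = (y k - x) / d 0 + d k / d 0"
        by (simp add: d_def flip: add_divide_distrib)
      then show ?case using constant_field_add[OF p Suc ratio[of k]] by simp
    qed (simp add: y_0 zero_in_constant_field[OF p])
    \<comment> \<open>Running a repetition forward by n - j steps gives a return to \<open>x\<close>
      after i + (n - j) < n steps.\<close>
    have y_neq: "y i \<noteq> y j" if ij: "i < j" "j < n" for i j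
    proof
      assume "y i = y j"
      then have "y (i + k) = y (j + k)" for k
        by (induction k) (simp_all add: y_Suc)
      from this[of "n - j"] have "y (i + (n - j)) = y n" using ij by simp
      then have "(?g ^^ (i + (n - j))) x = x" using n(2) by (simp add: y_def)
      then have "n \<le> i + (n - j)" using ij by (intro n_min) auto
      then show False using ij by simp
    qed
    have "inj_on (\<lambda>k. (y k - x) / d 0) {..<n}"
    proof (rule linorder_inj_onI)
      fix i j assume "i < j" "i \<in> {..<n}" "j \<in> {..<n}"
      then show "(y i - x) / d 0 \<noteq> (y j - x) / d 0" using y_neq[of i j] d_nz[of 0] by simp
    qed auto
    then have "card {..<n} \<le> card ?C"
      using diff finite_constant_field[OF assms(2)] by (intro card_inj_on_le) auto
    then show ?thesis by simp
  qed
  then show ?thesis using x_O by (simp add: n_def)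
qed

end
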